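(* Let $r\ge0$ be arbitrary. Then the function $\hat\phi_r:\mathbb{R}\times\hat\Omega_r\to\Lambda_r$, defined by $\hat\phi_r(a,\hat\omega)=\varphi_{r,a}(\hat\omega)$ for $(a,\hat\omega)\in\mathbb{R}\times\hat\Omega_r$, is onto.
   Context: Fix a constant $c>0$. For $0\le r<s$ and $a,b\in\mathbb{R}$ let $F_{r,a}=\{(t,x)\in\mathbb{R}^2: r\le t,\ a-c(t-r)\le x\le a+c(t-r)\}$, $B_{s,b}=\{(t,x)\in\mathbb{R}^2: t\le s,\ b-c(s-t)\le x\le b+c(s-t)\}$, and $P^{s,b}_{r,a}=F_{r,a}\cap B_{s,b}$ (nonempty if and only if $|b-a|\le c(s-r)$). When $P^{s,b}_{r,a}\ne\emptyset$ let $I^{s,b}_{r,a}=\{x\in\mathbb{R}:(\tfrac12(r+s),x)\in P^{s,b}_{r,a}\}$, a (possibly degenerate) closed interval. Also let $I^s_{r,a}=[a-c(s-r),a+c(s-r)]$. Standing assumptions: (i) for all such $r,s,a,b$ with $P^{s,b}_{r,a}\neq\emptyset$ we are given a continuous function $\lambda^{s,b}_{r,a}:[0,1]\to I^{s,b}_{r,a}$ mapping $[0,1]$ onto $I^{s,b}_{r,a}$, such that $(a,b,r,s,\xi)\mapsto\lambda^{s,b}_{r,a}(\xi)$ is continuous on $\{(a,b,r,s,\xi)\in\mathbb{R}^5: 0\le r<s,\ |b-a|\le c(s-r),\ \xi\in[0,1]\}$; (ii) for all $0\le r<s$ and $a\in\mathbb{R}$ we are given a continuous function $\lambda^s_{r,a}:[0,1]\to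 I^s_{r,a}$ onto $I^s_{r,a}$, such that $(a,r,s,\xi)\mapsto\lambda^s_{r,a}(\xi)$ is continuous on $\{(a,r,s,\xi):a\in\mathbb{R},\ 0\le r<s,\ \xi\in[0,1]\}$. For $0\le r<s$ let $t_{nj}=r+\frac{j}{2^n}(s-r)$ for $0\le j\le 2^n$, $n\ge 0$; $V^s_{r,n}=\{t_{nj}:0<j<2^n\}$ for $n\ge1$; $V^s_r=\bigcup_{n\ge1}V^s_{r,n}$; $\Omega^s_r=[0,1]^{V^s_r}$; $\hat V^s_r=V^s_r\cup\{s\}$, $\hat\Omega^s_r=[0,1]^{\hat V^s_r}$. The map $\hat\pi:\hat\Omega^s_r\to\Omega^s_r$ is restriction of coordinates to $V^s_r$. Let $\Lambda^s_r$ be the set of continuous $x:[r,s]\to\mathbb{R}$ with $|x(v)-x(u)|\le c|v-u|$ for all $u,v\in[r,s]$; $\Lambda^{s,b}_{r,a}=\{x\in\Lambda^s_r: x(r)=a,\ x(s)=b\}$, $\Lambda^s_{r,a}=\{x\in\Lambda^s_r:x(r)=a\}$. Let $C_r$ be the set of continuous functions $x:[r,+\infty)\to\mathbb{R}$, $\Lambda_r=\{x\in C_r:|x(v)-x(u)|\le c|v-u|\text{ for all }u,v\in[r,+\infty)\}$, $\Lambda_{r,a}=\{x\in\Lambda_r:x(r)=a\}$. Definition of $\varphi^{s,b}_{r,a}:\Omega^s_r\to\Lambda^{s,b}_{r,a}$ (when $P^{s,b}_{r,a}\neq\emptyset$): for $\omega\in\Omega^s_r$, the function $\varphi(\omega)=\varphi^{s,b}_{r,a}(\omega)$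 is defined on $V^s_r\cup\{r,s\}$ recursively by $\varphi(\omega)(r)=a$, $\varphi(\omega)(s)=b$, and, for $m\ge1$ and $1\le j\le 2^{m-1}$, writing $a_{m-1,i}=\varphi(\omega)(t_{m-1,i})$, $$\varphi(\omega)(t_{m,2j-1})=\lambda^{t_{m-1,j},a_{m-1,j}}_{t_{m-1,j-1},a_{m-1,j-1}}(\omega_{t_{m,2j-1}})$$ (at each step the relevant set $P^{t_{m-1,j},a_{m-1,j}}_{t_{m-1,j-1},a_{m-1,j-1}}$ is nonempty, and $t_{m,2j}=t_{m-1,j}$). The resulting function is $c$-Lipschitz on the dense set $V^s_r\cup\{r,s\}$ and $\varphi^{s,b}_{r,a}(\omega)\in\Lambda^{s,b}_{r,a}$ denotes its unique continuous extension to $[r,s]$. Definition of $\varphi^s_{r,a}:\hat\Omega^s_r\to\Lambda^s_{r,a}$: $\varphi^s_{r,a}(\hat\omega)=\varphi^{s,b}_{r,a}(\hat\pi(\hat\omega))$ with $b=\lambda^s_{r,a}(\hat\omega_s)$. Definition of $\varphi_{r,a}$: let $r\ge0$ and let $m$ be the smallest integer with $m>r$. Let $\hat V_r=\hat V^m_r\cup\bigcup_{j=m}^\infty\hat V^{j+1}_j$ and $\hat\Omega_r=[0,1]^{\hat V_r}$. For $\hat\omega\in\hat\Omega_r$ let $\hat\pi_{r,m}(\hat\omega)\in\hat\Omega^m_r$ and $\hat\pi_{j,j+1}(\hat\omega)\in\hat\Omega^{j+1}_j$ ($j\ge m$) be the restrictions of $\hat\omega$ to $\hat V^m_r$ and $\hat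 V^{j+1}_j$. For $a\in\mathbb{R}$, $\varphi_{r,a}(\hat\omega)\in\Lambda_{r,a}$ is the function given on $[r,m]$ by $\varphi^m_{r,a}(\hat\pi_{r,m}(\hat\omega))$ and, inductively for $j\ge m$, on $[j,j+1]$ by $\varphi^{j+1}_{j,d}(\hat\pi_{j,j+1}(\hat\omega))$ with $d=\varphi_{r,a}(\hat\omega)(j)$. *)

theory Defs
  imports "HOL-Analysis.Analysis"
begin

text \<open>
  Paths on an interval \<open>J\<close> are represented by functions that are extensional on \<open>J\<close>, and
  the product space \<open>[0,1]\<^sup>W\<close> by the extensional function space \<open>W \<rightarrow>\<^sub>E {0..1}\<close>, so that
  equality of such functions is equality on the intended domain.
\<close>

definition fwd_cone :: "real \<Rightarrow> real \<Rightarrow> real \<Rightarrow> (real \<times> real) set" where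
  "fwd_cone c r a = {(t, x). r \<le> t \<and> a - c * (t - r) \<le> x \<and> x \<le> a + c * (t - r)}"

definition bwd_cone :: "real \<Rightarrow> real \<Rightarrow> real \<Rightarrow> (real \<times> real) set" where
  "bwd_cone c s b = {(t, x). t \<le> s \<and> b - c * (s - t) \<le> x \<and> x \<le> b + c * (s - t)}"

definition par :: "real \<Rightarrow> real \<Rightarrow> real \<Rightarrow> real \<Rightarrow> real \<Rightarrow> (real \<times> real) set" where
  "par c r a s b = fwd_cone c r a \<inter> bwd_cone c s b"

definition mid_interval :: "real \<Rightarrow> real \<Rightarrow> real \<Rightarrow> real \<Rightarrow> real \<Rightarrow> real set" where
  "mid_interval c r a s b = {x. ((r + s) / 2, x) \<in> par c r a s b}"

definition end_interval :: "real \<Rightarrow> real \<Rightarrow> real \<Rightarrow> real \<Rightarrow> real set" where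
  "end_interval c r a s = {a - c * (s - r) .. a + c * (s - r)}"

text \<open>
  Standing assumptions on the two families: \<open>\<lambda>\<^sup>s\<^sup>,\<^sup>b\<^sub>r\<^sub>,\<^sub>a(\<xi>)\<close> is \<open>lam r a s b \<xi>\<close> and
  \<open>\<lambda>\<^sup>s\<^sub>r\<^sub>,\<^sub>a(\<xi>)\<close> is \<open>mu r a s \<xi>\<close>. Values outside the stated parameter ranges are
  unconstrained.
\<close>

definition mid_family ::
  "real \<Rightarrow> (real \<Rightarrow> real \<Rightarrow> real \<Rightarrow> real \<Rightarrow> real \<Rightarrow> real) \<Rightarrow> bool" where
  "mid_family c lam \<longleftrightarrow>
     (\<forall>r a s b. 0 \<le> r \<and> r < s \<and> par c r a s b \<noteq> {} \<longrightarrow>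
        continuous_on {0..1} (lam r a s b) \<and>
        lam r a s b ` {0..1} = mid_interval c r a s b) \<and>
     continuous_on
       {(a, b, r, s, \<xi>). 0 \<le> r \<and> r < s \<and> \<bar>b - a\<bar> \<le> c * (s - r) \<and> \<xi> \<in> {0..1}}
       (\<lambda>(a, b, r, s, \<xi>). lam r a s b \<xi>)"

definition end_family ::
  "real \<Rightarrow> (real \<Rightarrow> real \<Rightarrow> real \<Rightarrow> real \<Rightarrow> real) \<Rightarrow> bool" where
  "end_family c mu \<longleftrightarrow>
     (\<forall>r a s. 0 \<le> r \<and> r < s \<longrightarrow>
        continuous_on {0..1} (mu r a s) \<and>
        mu r a s ` {0..1} = end_interval c r a s) \<and>
     continuous_on
       {(a, r, s, \<xi>). 0 \<le> r \<and> r < s \<and> \<xi> \<in> {0..1}}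
       (\<lambda>(a, r, s, \<xi>). mu r a s \<xi>)"

definition dyadic :: "real \<Rightarrow> real \<Rightarrow> nat \<Rightarrow> nat \<Rightarrow> real" where
  "dyadic r s n j = r + real j / 2 ^ n * (s - r)"

definition V_level :: "real \<Rightarrow> real \<Rightarrow> nat \<Rightarrow> real set" where
  "V_level r s n = {dyadic r s n j | j. 0 < j \<and> j < 2 ^ n}"

definition V :: "real \<Rightarrow> real \<Rightarrow> real set" where
  "V r s = (\<Union>n\<in>{1..}. V_level r s n)"

definition V_hat :: "real \<Rightarrow> real \<Rightarrow> real set" where
  "V_hat r s = V r s \<union> {s}"

text \<open>
  \<open>bridge_node lam r a s b \<omega> n j\<close> is the value \<open>\<phi>(\<omega>)(t\<^sub>n\<^sub>j)\<close>, meaningful for \<open>j \<le> 2 ^ n\<close>.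
  An even index at level \<open>Suc m\<close> denotes a point of level \<open>m\<close>; an odd index \<open>2i + 1\<close> denotes
  the midpoint of the points \<open>i\<close> and \<open>i + 1\<close> of level \<open>m\<close>.
\<close>

primrec bridge_node ::
  "(real \<Rightarrow> real \<Rightarrow> real \<Rightarrow> real \<Rightarrow> real \<Rightarrow> real) \<Rightarrow> real \<Rightarrow> real \<Rightarrow> real \<Rightarrow> real \<Rightarrow>
   (real \<Rightarrow> real) \<Rightarrow> nat \<Rightarrow> nat \<Rightarrow> real" where
  "bridge_node lam r a s b \<omega> 0 j = (if j = 0 then a else b)"
| "bridge_node lam r a s b \<omega> (Suc m) j =
     (if even j then bridge_node lam r a s b \<omega> m (j div 2)
      else lam (dyadic r s m (j div 2)) (bridge_node lam r a s b \<omega> m (j div 2))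
               (dyadic r s m (j div 2 + 1)) (bridge_node lam r a s b \<omega> m (j div 2 + 1))
               (\<omega> (dyadic r s (Suc m) j)))"

definition bridge ::
  "(real \<Rightarrow> real \<Rightarrow> real \<Rightarrow> real \<Rightarrow> real \<Rightarrow> real) \<Rightarrow> real \<Rightarrow> real \<Rightarrow> real \<Rightarrow> real \<Rightarrow>
   (real \<Rightarrow> real) \<Rightarrow> (real \<Rightarrow> real)" where
  "bridge lam r a s b \<omega> =
     (THE x. x \<in> extensional {r..s} \<and> continuous_on {r..s} x \<and>
        (\<forall>n j. j \<le> 2 ^ n \<longrightarrow> x (dyadic r s n j) = bridge_node lam r a s b \<omega> n j))"

definition free_path ::
  "(real \<Rightarrow> real \<Rightarrow> real \<Rightarrow> real \<Rightarrow> real \<Rightarrow> real) \<Rightarrow> (real \<Rightarrow> real \<Rightarrow> real \<Rightarrow> real \<Rightarrow> real) \<Rightarrow>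
   real \<Rightarrow> real \<Rightarrow> real \<Rightarrow> (real \<Rightarrow> real) \<Rightarrow> (real \<Rightarrow> real)" where
  "free_path lam mu r a s \<omega> = bridge lam r a s (mu r a s (\<omega> s)) (restrict \<omega> (V r s))"

text \<open>For \<open>r \<ge> 0\<close> the smallest integer exceeding \<open>r\<close> is a natural number.\<close>

definition next_int :: "real \<Rightarrow> nat" where
  "next_int r = (LEAST m. r < real m)"

definition V_ray :: "real \<Rightarrow> real set" where
  "V_ray r = V_hat r (real (next_int r)) \<union>
     (\<Union>j\<in>{next_int r..}. V_hat (real j) (real (j + 1)))"

definition Omega_ray :: "real \<Rightarrow> (real \<Rightarrow> real) set" where
  "Omega_ray r = V_ray r \<rightarrow>\<^sub>E {0..1}"

text \<open>
  \<open>ray_upto lam mu r a \<omega> k\<close> is the path \<open>\<phi>\<^sub>r\<^sub>,\<^sub>a(\<omega>)\<close> on \<open>[r, m + k]\<close>, where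
  \<open>m = next_int r\<close>.
\<close>

primrec ray_upto ::
  "(real \<Rightarrow> real \<Rightarrow> real \<Rightarrow> real \<Rightarrow> real \<Rightarrow> real) \<Rightarrow> (real \<Rightarrow> real \<Rightarrow> real \<Rightarrow> real \<Rightarrow> real) \<Rightarrow>
   real \<Rightarrow> real \<Rightarrow> (real \<Rightarrow> real) \<Rightarrow> nat \<Rightarrow> (real \<Rightarrow> real)" where
  "ray_upto lam mu r a \<omega> 0 =
     free_path lam mu r a (real (next_int r)) (restrict \<omega> (V_hat r (real (next_int r))))"
| "ray_upto lam mu r a \<omega> (Suc k) =
     (let x = ray_upto lam mu r a \<omega> k; j = next_int r + k in
      (\<lambda>t. if t \<le> real j then x t
           else free_path lam mu (real j) (x (real j)) (real (j + 1))
                  (restrict \<omega> (V_hat (real j) (real (j + 1)))) t))"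

definition ray_path ::
  "(real \<Rightarrow> real \<Rightarrow> real \<Rightarrow> real \<Rightarrow> real \<Rightarrow> real) \<Rightarrow> (real \<Rightarrow> real \<Rightarrow> real \<Rightarrow> real \<Rightarrow> real) \<Rightarrow>
   real \<Rightarrow> real \<Rightarrow> (real \<Rightarrow> real) \<Rightarrow> (real \<Rightarrow> real)" where
  "ray_path lam mu r a \<omega> =
     (\<lambda>t\<in>{r..}. ray_upto lam mu r a \<omega> (LEAST k. t \<le> real (next_int r + k)) t)"

definition phi_hat ::
  "(real \<Rightarrow> real \<Rightarrow> real \<Rightarrow> real \<Rightarrow> real \<Rightarrow> real) \<Rightarrow> (real \<Rightarrow> real \<Rightarrow> real \<Rightarrow> real \<Rightarrow> real) \<Rightarrow>
   real \<Rightarrow> real \<times> (real \<Rightarrow> real) \<Rightarrow> (real \<Rightarrow> real)" where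
  "phi_hat lam mu r = (\<lambda>(a, \<omega>). ray_path lam mu r a \<omega>)"

definition C_ray :: "real \<Rightarrow> (real \<Rightarrow> real) set" where
  "C_ray r = {x \<in> extensional {r..}. continuous_on {r..} x}"

definition Lambda_ray :: "real \<Rightarrow> real \<Rightarrow> (real \<Rightarrow> real) set" where
  "Lambda_ray c r = {x \<in> C_ray r. \<forall>u\<in>{r..}. \<forall>v\<in>{r..}. \<bar>x v - x u\<bar> \<le> c * \<bar>v - u\<bar>}"

end

theory Submission
  imports Defs
begin

text \<open>
  The parallelogram \<open>par c r a s b\<close> meets its middle vertical line exactly in the values that a
  \<open>c\<close>-Lipschitz path from \<open>(r, a)\<close> to \<open>(s, b)\<close> can take at time \<open>(r + s) / 2\<close>. Since the maps \<open>lam\<close>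
  are onto these intervals, the coordinates of \<open>\<omega>\<close> at the dyadic points can be chosen one after the
  other so that the recursion reproduces the values of any prescribed Lipschitz path; each dyadic
  point is a midpoint in exactly one step, so the choices never compete for a coordinate. A
  continuous path is determined by its values on the dense set of dyadic points, so the bridge
  built from this \<open>\<omega>\<close> is the given path (\<open>bridge_surj\<close>). Surjectivity of \<open>mu\<close> adds the free end
  value (\<open>free_path_surj\<close>).

  The half-line is cut at \<open>r\<close> and at the integers beyond it. The coordinate sets of the pieces are
  disjoint, because the piece between two consecutive cut points uses only coordinates in the
  half-open interval that excludes its left end. Hence the coordinates found for the pieces
  combine to one \<open>\<omega>\<close>, and induction along the cut points shows that the path of \<open>\<omega>\<close> is the given
  one (\<open>ray_path_surj\<close>).

  That the map has its values in \<open>Lambda_ray c r\<close> is part of the claim. The recursion makes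
  neighbouring dyadic values of each level differ by at most \<open>c\<close> times their distance; these
  bounds add up to a Lipschitz bound on all dyadic points, which extends to the closed interval
  (\<open>bridge_lipschitz_nodes\<close>) and then across the cut points (\<open>ray_path_props\<close>).
\<close>

section \<open>Intervals and dyadic points\<close>

lemma mem_mid_interval_iff:
  assumes "r \<le> s"
  shows "x \<in> mid_interval c r a s b \<longleftrightarrow>
    \<bar>x - a\<bar> \<le> c * ((s - r) / 2) \<and> \<bar>b - x\<bar> \<le> c * ((s - r) / 2)"
proof -
  define h where "h = c * ((s - r) / 2)"
  have half: "(r + s) / 2 - r = (s - r) / 2" "s - (r + s) / 2 = (s - r) / 2"
    by (simp_all add: field_simps)
  have "x \<in> mid_interval c r a s b \<longleftrightarrow> r \<le> (r + s) / 2 \<and> (r + s) / 2 \<le> s \<and>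
      a - h \<le> x \<and> x \<le> a + h \<and> b - h \<le> x \<and> x \<le> b + h"
    unfolding mid_interval_def par_def fwd_cone_def bwd_cone_def h_def by (auto simp only: half
      mem_Collect_eq Int_iff case_prod_conv)
  also have "\<dots> \<longleftrightarrow> \<bar>x - a\<bar> \<le> h \<and> \<bar>b - x\<bar> \<le> h" using assms by auto
  finally show ?thesis unfolding h_def .
qed

text \<open>The straight line from \<open>(r, a)\<close> to \<open>(s, b)\<close> passes through the parallelogram.\<close>

lemma par_nonempty:
  assumes "r \<le> s" "\<bar>b - a\<bar> \<le> c * (s - r)"
  shows "par c r a s b \<noteq> {}"
proof -
  have "(a + b) / 2 \<in> mid_interval c r a s b"
    unfolding mem_mid_interval_iff[OF assms(1)] using assms(2) by (simp add: field_simps abs_le_iff)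
  then show ?thesis unfolding mid_interval_def by auto
qed

lemma mid_family_image:
  assumes "mid_family c lam" "0 \<le> r" "r < s" "\<bar>b - a\<bar> \<le> c * (s - r)"
  shows "lam r a s b ` {0..1} = mid_interval c r a s b"
  using assms par_nonempty[of r s b a c] unfolding mid_family_def by auto

lemma end_family_image:
  assumes "end_family c mu" "0 \<le> r" "r < s"
  shows "mu r a s ` {0..1} = {b. \<bar>b - a\<bar> \<le> c * (s - r)}"
proof -
  have "mu r a s ` {0..1} = end_interval c r a s"
    using assms unfolding end_family_def by auto
  then show ?thesis unfolding end_interval_def by (auto simp: abs_le_iff)
qed

lemma dyadic_0 [simp]: "dyadic r s n 0 = r"
  by (simp add: dyadic_def)

lemma dyadic_end [simp]: "dyadic r s n (2 ^ n) = s"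
  by (simp add: dyadic_def)

lemma dyadic_scale: "dyadic r s (n + k) (2 ^ k * j) = dyadic r s n j"
  by (simp add: dyadic_def power_add)

lemma dyadic_double: "dyadic r s (Suc n) (2 * j) = dyadic r s n j"
  by (simp add: dyadic_def)

lemma dyadic_diff: "dyadic r s n j - dyadic r s n i = (real j - real i) / 2 ^ n * (s - r)"
  by (simp add: dyadic_def field_simps)

lemma dyadic_Suc_diff: "dyadic r s n (Suc j) - dyadic r s n j = (s - r) / 2 ^ n"
  by (simp add: dyadic_diff)

lemma dyadic_mono: "r \<le> s \<Longrightarrow> i \<le> j \<Longrightarrow> dyadic r s n i \<le> dyadic r s n j"
  by (simp add: dyadic_def divide_right_mono mult_right_mono)

lemma dyadic_strict_mono: "r < s \<Longrightarrow> i < j \<Longrightarrow> dyadic r s n i < dyadic r s n j"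
  by (simp add: dyadic_def divide_strict_right_mono)

lemma dyadic_mem: "r \<le> s \<Longrightarrow> j \<le> 2 ^ n \<Longrightarrow> dyadic r s n j \<in> {r..s}"
  using dyadic_mono[of r s 0 j n] dyadic_mono[of r s j "2 ^ n" n] by simp

lemma dyadic_eq_iff:
  assumes "r < s"
  shows "dyadic r s n j = dyadic r s m i \<longleftrightarrow> 2 ^ m * j = 2 ^ n * i"
proof -
  have "dyadic r s n j = dyadic r s m i \<longleftrightarrow> real j / 2 ^ n = real i / 2 ^ m"
    using assms by (simp only: dyadic_def add_left_cancel) (simp del: times_divide_eq_left)
  also have "\<dots> \<longleftrightarrow> real (2 ^ m * j) = real (2 ^ n * i)"
    by (simp add: field_simps)
  finally show ?thesis unfolding of_nat_eq_iff .
qed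

lemma V_subset: "r < s \<Longrightarrow> V r s \<subseteq> {r<..<s}"
proof
  fix t assume "r < s" "t \<in> V r s"
  then obtain n j where "t = dyadic r s n j" "0 < j" "j < 2 ^ n"
    unfolding V_def V_level_def by auto
  then show "t \<in> {r<..<s}"
    using dyadic_strict_mono[OF \<open>r < s\<close>, of 0 j n] dyadic_strict_mono[OF \<open>r < s\<close>, of j "2 ^ n" n]
    by simp
qed

lemma V_hat_subset: "r < s \<Longrightarrow> V_hat r s \<subseteq> {r<..s}"
  using V_subset[of r s] unfolding V_hat_def by auto

lemma odd_dyadic_mem_V:
  assumes "i < 2 ^ m"
  shows "dyadic r s (Suc m) (2 * i + 1) \<in> V r s"
proof -
  have "2 * i + 1 < 2 ^ Suc m" using assms by simp
  then have "dyadic r s (Suc m) (2 * i + 1) \<in> V_level r s (Suc m)"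
    unfolding V_level_def by (intro CollectI exI[of _ "2 * i + 1"]) simp
  then show ?thesis unfolding V_def by (intro UN_I[of "Suc m"]) simp_all
qed

text \<open>
  By parity: comparing two levels, the fraction of the coarser one gets an even numerator.
  This is what allows the coordinates to be chosen independently in \<open>bridge_surj\<close>.
\<close>

lemma odd_dyadic_unique:
  assumes "r < s" and eq: "dyadic r s (Suc m) (2 * i + 1) = dyadic r s (Suc n) (2 * j + 1)"
  shows "m = n \<and> i = j"
proof -
  have *: "2 ^ Suc n * (2 * i + 1) = (2 ^ Suc m * (2 * j + 1) :: nat)"
    using eq unfolding dyadic_eq_iff[OF assms(1)] .
  have no: False
    if "2 ^ Suc q * (2 * k + 1) = (2 ^ Suc p * (2 * l + 1) :: nat)" "p < q" for p q k l
  proof -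
    obtain d where d: "q = Suc (p + d)" using \<open>p < q\<close> less_iff_Suc_add by auto
    have "2 ^ Suc p * (2 * (2 ^ d * (2 * k + 1))) = (2 ^ Suc p * (2 * l + 1) :: nat)"
      using that(1) unfolding d by (simp only: power_Suc power_add mult.assoc mult.left_commute)
    then have "2 * (2 ^ d * (2 * k + 1)) = 2 * l + 1" by (simp only: mult_cancel1) simp
    then have "even (2 * l + 1)" by (metis dvd_triv_left)
    then show False by simp
  qed
  have "m = n" using no[OF *] no[OF *[symmetric]] by (metis linorder_neqE_nat)
  then show ?thesis using * by simp
qed

lemma closure_dyadic:
  assumes "r < s"
  shows "closure {dyadic r s n j |n j. j \<le> 2 ^ n} = {r..s}" (is "closure ?D = _")
proof
  have "?D \<subseteq> {r..s}" using dyadic_mem[of r s] assms by auto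
  then show "closure ?D \<subseteq> {r..s}" by (rule closure_minimal) simp
  show "{r..s} \<subseteq> closure ?D"
  proof
    fix t assume t: "t \<in> {r..s}"
    have "\<exists>y\<in>?D. dist y t < e" if e: "e > 0" for e
    proof -
      obtain n where "(1 / 2) ^ n < e / (s - r)"
        using real_arch_pow_inv[of "e / (s - r)" "1 / 2"] e assms by auto
      then have n: "(s - r) / 2 ^ n < e"
        using assms by (simp add: field_simps power_divide)
      define q where "q = (t - r) / (s - r) * 2 ^ n"
      have q: "0 \<le> q" "q \<le> 2 ^ n" using t assms by (auto simp: q_def field_simps)
      define j where "j = nat \<lfloor>q\<rfloor>"
      have j: "real j \<le> q" "q < real j + 1" using q by (auto simp: j_def)
      have "real j \<le> 2 ^ n" using j q by linarith
      then have "real j \<le> real (2 ^ n)" by simp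
      then have "j \<le> 2 ^ n" unfolding of_nat_le_iff .
      moreover have "t - dyadic r s n j = (q - real j) * ((s - r) / 2 ^ n)"
        using assms by (simp add: dyadic_def q_def field_simps)
      moreover have "0 \<le> (q - real j) * ((s - r) / 2 ^ n)" using j assms by simp
      moreover have "(q - real j) * ((s - r) / 2 ^ n) \<le> 1 * ((s - r) / 2 ^ n)"
        using j assms by (intro mult_right_mono) auto
      ultimately have "dist (dyadic r s n j) t < e"
        using n by (simp add: dist_real_def)
      with \<open>j \<le> 2 ^ n\<close> show ?thesis by blast
    qed
    then show "t \<in> closure ?D" unfolding closure_approachable by blast
  qed
qed

section \<open>Paths between two prescribed values\<close>

text \<open>The value computed at a point does not depend on the level at which the point is viewed.\<close>

lemma bridge_node_scale: "bridge_node lam r a s b \<omega> (n + k) (2 ^ k * j) = bridge_node lam r a s b \<omega> n j"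
  by (induction k) (simp_all add: mult.assoc)

lemma bridge_node_odd:
  "bridge_node lam r a s b \<omega> (Suc m) (2 * i + 1) =
     lam (dyadic r s m i) (bridge_node lam r a s b \<omega> m i)
         (dyadic r s m (Suc i)) (bridge_node lam r a s b \<omega> m (Suc i))
         (\<omega> (dyadic r s (Suc m) (2 * i + 1)))"
  by simp

text \<open>
  The values of \<open>lam\<close> lie in the middle interval, whose points are within \<open>c\<close> times half the gap from
  both neighbouring values. So the bound is inherited by the next level, and with it the
  condition under which \<open>lam\<close> is controlled at all.
\<close>

lemma bridge_node_step:
  assumes lam: "mid_family c lam" and rs: "0 \<le> r" "r < s" and ab: "\<bar>b - a\<bar> \<le> c * (s - r)"
    and \<omega>: "\<omega> \<in> V r s \<rightarrow> {0..1}" and "j < 2 ^ n"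
  shows "\<bar>bridge_node lam r a s b \<omega> n (Suc j) - bridge_node lam r a s b \<omega> n j\<bar> \<le> c * ((s - r) / 2 ^ n)"
  using \<open>j < 2 ^ n\<close>
proof (induction n arbitrary: j)
  case 0
  then show ?case using ab by simp
next
  case (Suc n)
  let ?N = "bridge_node lam r a s b \<omega>"
  define i where "i = j div 2"
  have i: "i < 2 ^ n" using Suc.prems by (auto simp: i_def)
  have gap: "dyadic r s n (Suc i) - dyadic r s n i = (s - r) / 2 ^ n"
    by (rule dyadic_Suc_diff)
  have "0 \<le> dyadic r s n i" using dyadic_mem[of r s i n] rs i by auto
  moreover have lt: "dyadic r s n i < dyadic r s n (Suc i)" using dyadic_strict_mono rs by simp
  moreover have "\<bar>?N n (Suc i) - ?N n i\<bar> \<le> c * (dyadic r s n (Suc i) - dyadic r s n i)"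
    unfolding gap using Suc.IH[OF i] .
  ultimately have "lam (dyadic r s n i) (?N n i) (dyadic r s n (Suc i)) (?N n (Suc i)) ` {0..1}
      = mid_interval c (dyadic r s n i) (?N n i) (dyadic r s n (Suc i)) (?N n (Suc i))"
    by (rule mid_family_image[OF lam])
  moreover have "\<omega> (dyadic r s (Suc n) (2 * i + 1)) \<in> {0..1}"
    using \<omega> odd_dyadic_mem_V[OF i] by blast
  ultimately have "?N (Suc n) (2 * i + 1)
      \<in> mid_interval c (dyadic r s n i) (?N n i) (dyadic r s n (Suc i)) (?N n (Suc i))"
    unfolding bridge_node_odd by blast
  then have m: "\<bar>?N (Suc n) (2 * i + 1) - ?N n i\<bar> \<le> c * ((s - r) / 2 ^ Suc n)"
      "\<bar>?N n (Suc i) - ?N (Suc n) (2 * i + 1)\<bar> \<le> c * ((s - r) / 2 ^ Suc n)"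
    unfolding mem_mid_interval_iff[OF less_imp_le[OF lt]] gap by (simp_all add: mult.commute)
  have e: "?N (Suc n) (2 * i) = ?N n i" "?N (Suc n) (2 * i + 2) = ?N n (Suc i)" by simp_all
  show ?case
  proof (cases "even j")
    case True
    then have "j = 2 * i" by (simp add: i_def)
    then show ?thesis using m(1) e(1) by (simp del: bridge_node.simps)
  next
    case False
    then have "j = 2 * i + 1" by (simp add: i_def)
    then show ?thesis using m(2) e(2) by (simp del: bridge_node.simps)
  qed
qed

lemma bridge_node_lipschitz:
  assumes lam: "mid_family c lam" and rs: "0 \<le> r" "r < s" and ab: "\<bar>b - a\<bar> \<le> c * (s - r)"
    and \<omega>: "\<omega> \<in> V r s \<rightarrow> {0..1}" and "i \<le> j" "j \<le> 2 ^ n"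
  shows "\<bar>bridge_node lam r a s b \<omega> n j - bridge_node lam r a s b \<omega> n i\<bar>
     \<le> c * (dyadic r s n j - dyadic r s n i)"
  using \<open>i \<le> j\<close> \<open>j \<le> 2 ^ n\<close>
proof (induction j rule: dec_induct)
  case base
  then show ?case by simp
next
  case (step j)
  let ?N = "bridge_node lam r a s b \<omega> n"
  have "\<bar>?N (Suc j) - ?N j\<bar> \<le> c * (dyadic r s n (Suc j) - dyadic r s n j)"
    unfolding dyadic_Suc_diff using bridge_node_step[OF lam rs ab \<omega>] step by simp
  moreover have "\<bar>?N j - ?N i\<bar> \<le> c * (dyadic r s n j - dyadic r s n i)"
    using step by simp
  ultimately show ?case by (simp add: algebra_simps)
qed

text \<open>
  The description defining \<open>bridge\<close> has at most one solution, as the dyadic points are dense. Every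
  path that interpolates the nodes continuously is therefore the bridge.
\<close>

lemma bridge_eqI:
  assumes "r < s" and x: "x \<in> extensional {r..s}" "continuous_on {r..s} x"
    and nodes: "\<And>n j. j \<le> 2 ^ n \<Longrightarrow> x (dyadic r s n j) = bridge_node lam r a s b \<omega> n j"
  shows "bridge lam r a s b \<omega> = x"
  unfolding bridge_def
proof (rule the_equality)
  show "x \<in> extensional {r..s} \<and> continuous_on {r..s} x \<and>
      (\<forall>n j. j \<le> 2 ^ n \<longrightarrow> x (dyadic r s n j) = bridge_node lam r a s b \<omega> n j)"
    by (intro conjI allI impI x nodes)
  fix y
  assume y: "y \<in> extensional {r..s} \<and> continuous_on {r..s} y \<and>
      (\<forall>n j. j \<le> 2 ^ n \<longrightarrow> y (dyadic r s n j) = bridge_node lam r a s b \<omega> n j)"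
  have "y t - x t = 0" if "t \<in> {r..s}" for t
  proof (rule continuous_constant_on_closure[of "{dyadic r s n j |n j. j \<le> 2 ^ n}" "\<lambda>t. y t - x t"])
    show "continuous_on (closure {dyadic r s n j |n j. j \<le> 2 ^ n}) (\<lambda>t. y t - x t)"
      unfolding closure_dyadic[OF \<open>r < s\<close>]
      by (intro continuous_on_diff x(2)) (use y in blast)
    show "y t - x t = 0" if t: "t \<in> {dyadic r s n j |n j. j \<le> 2 ^ n}" for t
    proof -
      obtain n j where "j \<le> 2 ^ n" "t = dyadic r s n j" using t by blast
      then show ?thesis using y nodes[of j n] by simp
    qed
    show "t \<in> closure {dyadic r s n j |n j. j \<le> 2 ^ n}"
      unfolding closure_dyadic[OF \<open>r < s\<close>] by fact
  qed
  then have "y t = x t" if "t \<in> {r..s}" for t using that by fastforce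
  moreover have "y \<in> extensional {r..s}" using y by blast
  ultimately show "y = x" using x(1) by (intro extensionalityI[of y "{r..s}" x])
qed

text \<open>
  Existence for the description defining \<open>bridge\<close>: the node values form a Lipschitz function on the
  dyadic points, and such a function extends to the closure with the same constant.
\<close>

lemma bridge_lipschitz_nodes:
  assumes c: "0 \<le> c" and lam: "mid_family c lam" and rs: "0 \<le> r" "r < s"
    and ab: "\<bar>b - a\<bar> \<le> c * (s - r)" and \<omega>: "\<omega> \<in> V r s \<rightarrow> {0..1}"
  shows "c-lipschitz_on {r..s} (bridge lam r a s b \<omega>)"
    and "\<And>n j. j \<le> 2 ^ n \<Longrightarrow> bridge lam r a s b \<omega> (dyadic r s n j) = bridge_node lam r a s b \<omega> n j"
proof -
  let ?N = "bridge_node lam r a s b \<omega>"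
  let ?D = "{dyadic r s n j |n j. j \<le> 2 ^ n}"
  have wd: "?N n j = ?N m i" if "dyadic r s n j = dyadic r s m i" for n m i j
    using that bridge_node_scale[of lam r a s b \<omega> n m j] bridge_node_scale[of lam r a s b \<omega> m n i]
    unfolding dyadic_eq_iff[OF rs(2)] by (simp add: add.commute)
  define f where "f t = (SOME y. \<exists>n j. t = dyadic r s n j \<and> y = ?N n j)" for t
  have f: "f (dyadic r s n j) = ?N n j" for n j
    unfolding f_def
  proof (rule some_equality)
    show "\<exists>n' j'. dyadic r s n j = dyadic r s n' j' \<and> ?N n j = ?N n' j'" by blast
    show "y = ?N n j" if "\<exists>n' j'. dyadic r s n j = dyadic r s n' j' \<and> y = ?N n' j'" for y
      using that wd by metis
  qed
  have "c-lipschitz_on ?D f"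
  proof (rule lipschitz_onI)
    fix u v assume "u \<in> ?D" "v \<in> ?D"
    then obtain n j m i where u: "u = dyadic r s n j" "j \<le> 2 ^ n"
      and v: "v = dyadic r s m i" "i \<le> 2 ^ m" by blast
    \<comment> \<open>View both points at the common level \<open>n + m\<close>.\<close>
    define p where "p = 2 ^ m * j"
    define q where "q = 2 ^ n * i"
    have u': "u = dyadic r s (n + m) p" unfolding u p_def dyadic_scale ..
    have v': "v = dyadic r s (n + m) q"
      unfolding v q_def using dyadic_scale[of r s m n i] by (simp add: add.commute)
    have le: "p \<le> 2 ^ (n + m)" "q \<le> 2 ^ (n + m)"
      using u(2) v(2) by (simp_all add: p_def q_def power_add mult.commute)
    have "\<bar>f u - f v\<bar> \<le> c * \<bar>u - v\<bar>"
    proof (cases "p \<le> q")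
      case True
      then show ?thesis
        using bridge_node_lipschitz[OF lam rs ab \<omega> True le(2)] dyadic_mono[of r s p q "n + m"] rs
        unfolding u' v' f by (simp add: abs_minus_commute)
    next
      case False
      then show ?thesis
        using bridge_node_lipschitz[OF lam rs ab \<omega> _ le(1), of q] dyadic_mono[of r s q p "n + m"] rs
        unfolding u' v' f by (simp add: abs_minus_commute)
    qed
    then show "dist (f u) (f v) \<le> c * dist u v" by (simp add: dist_real_def)
  qed (fact c)
  from lipschitz_extend_closure[OF this]
  obtain g where g: "c-lipschitz_on {r..s} g" "\<forall>t\<in>?D. g t = f t"
    unfolding closure_dyadic[OF rs(2)] by (elim exE conjE)
  define x where "x = restrict g {r..s}"
  have lip: "c-lipschitz_on {r..s} x"
    using g(1) by (rule lipschitz_on_transform) (simp add: x_def)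
  have nodes: "x (dyadic r s n j) = ?N n j" if "j \<le> 2 ^ n" for n j
  proof -
    have "x (dyadic r s n j) = g (dyadic r s n j)"
      using dyadic_mem[of r s j n] that rs by (simp add: x_def)
    also have "\<dots> = f (dyadic r s n j)" using that by (intro bspec[OF g(2)]) blast
    finally show ?thesis unfolding f .
  qed
  have "x \<in> extensional {r..s}" by (simp add: x_def)
  with rs(2) have "bridge lam r a s b \<omega> = x"
    using lipschitz_on_continuous_on[OF lip] nodes by (rule bridge_eqI)
  then show "c-lipschitz_on {r..s} (bridge lam r a s b \<omega>)"
    and "\<And>n j. j \<le> 2 ^ n \<Longrightarrow> bridge lam r a s b \<omega> (dyadic r s n j) = ?N n j"
    using lip nodes by simp_all
qed

text \<open>
  A Lipschitz path takes at each midpoint a value of the middle interval belonging to its values at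
  the two neighbours, so some parameter of \<open>lam\<close> attains it. With these parameters as coordinates the
  nodes agree with the path, by induction on the level.
\<close>

lemma bridge_surj:
  assumes lam: "mid_family c lam" and rs: "0 \<le> r" "r < s"
    and x: "x \<in> extensional {r..s}" "c-lipschitz_on {r..s} x"
  obtains \<omega> where "\<omega> \<in> V r s \<rightarrow> {0..1}" "bridge lam r (x r) s (x s) \<omega> = x"
proof -
  let ?P = "\<lambda>m i \<xi>. \<xi> \<in> {0..1} \<and> lam (dyadic r s m i) (x (dyadic r s m i))
     (dyadic r s m (Suc i)) (x (dyadic r s m (Suc i))) \<xi> = x (dyadic r s (Suc m) (2 * i + 1))"
  have ex: "\<exists>\<xi>. ?P m i \<xi>" if i: "i < 2 ^ m" for m i
  proof -
    let ?u = "dyadic r s m i" and ?v = "dyadic r s m (Suc i)" and ?w = "dyadic r s (Suc m) (2 * i + 1)"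
    have in_rs: "?u \<in> {r..s}" "?v \<in> {r..s}" "?w \<in> {r..s}"
      using i rs dyadic_mem[of r s i m] dyadic_mem[of r s "Suc i" m]
        dyadic_mem[of r s "2 * i + 1" "Suc m"] by auto
    have uv: "?u < ?v" using dyadic_strict_mono rs by simp
    have w: "?w - ?u = (?v - ?u) / 2" "?v - ?w = (?v - ?u) / 2"
      by (simp_all add: dyadic_def field_simps)
    have lip: "\<bar>x q - x p\<bar> \<le> c * (q - p)" if "p \<in> {r..s}" "q \<in> {r..s}" "p \<le> q" for p q
      using lipschitz_onD[OF x(2) that(2,1)] that(3) by (simp add: dist_real_def)
    have "?u \<le> ?w" "?w \<le> ?v" using uv w by linarith+
    then have "x ?w \<in> mid_interval c ?u (x ?u) ?v (x ?v)"
      unfolding mem_mid_interval_iff[OF less_imp_le[OF uv]]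
      using lip[OF in_rs(1,3)] lip[OF in_rs(3,2)] \<open>?u \<le> ?w\<close> \<open>?w \<le> ?v\<close>
      unfolding w by blast
    also have "\<dots> = lam ?u (x ?u) ?v (x ?v) ` {0..1}"
      using mid_family_image[OF lam _ uv lip[OF in_rs(1,2)]] in_rs(1) rs(1) uv by simp
    finally show ?thesis by (metis imageE)
  qed
  define \<Xi> where "\<Xi> m i = (SOME \<xi>. ?P m i \<xi>)" for m i
  have \<Xi>: "?P m i (\<Xi> m i)" if "i < 2 ^ m" for m i
    unfolding \<Xi>_def using ex[OF that] by (rule someI_ex)
  \<comment> \<open>Transport the parameters from the index pairs to the dyadic points that these denote.\<close>
  let ?Q = "\<lambda>t y. \<exists>m i. i < 2 ^ m \<and> t = dyadic r s (Suc m) (2 * i + 1) \<and> y = \<Xi> m i"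
  define \<omega> where "\<omega> t = (if \<exists>y. ?Q t y then SOME y. ?Q t y else 0)" for t
  have \<omega>: "\<omega> (dyadic r s (Suc m) (2 * i + 1)) = \<Xi> m i" if "i < 2 ^ m" for m i
  proof -
    let ?t = "dyadic r s (Suc m) (2 * i + 1)"
    have Q: "?Q ?t (\<Xi> m i)" using that by blast
    moreover have "y = \<Xi> m i" if "?Q ?t y" for y
      using that odd_dyadic_unique[OF rs(2)] by blast
    ultimately have "(SOME y. ?Q ?t y) = \<Xi> m i" by (rule some_equality)
    then show ?thesis unfolding \<omega>_def using exI[of "?Q ?t", OF Q] by (simp only: if_True)
  qed
  have range: "\<omega> t \<in> {0..1}" for t
  proof (cases "\<exists>y. ?Q t y")
    case True
    then obtain m i where i: "i < 2 ^ m" and t: "t = dyadic r s (Suc m) (2 * i + 1)" by blast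
    show ?thesis unfolding t \<omega>[OF i] using \<Xi>[OF i] by (rule conjunct1)
  next
    case False
    then show ?thesis unfolding \<omega>_def by (simp only: if_False) simp
  qed
  have nodes: "x (dyadic r s n j) = bridge_node lam r (x r) s (x s) \<omega> n j" if "j \<le> 2 ^ n" for n j
    using that
  proof (induction n arbitrary: j)
    case 0
    then have "j = 0 \<or> j = 1" by auto
    then show ?case using dyadic_end[of r s 0] by auto
  next
    case (Suc n)
    define i where "i = j div 2"
    show ?case
    proof (cases "even j")
      case True
      then have j: "j = 2 * i" by (simp add: i_def)
      show ?thesis using Suc unfolding j dyadic_double by simp
    next
      case False
      then have j: "j = 2 * i + 1" by (simp add: i_def)
      have i: "i < 2 ^ n" using Suc.prems j by simp
      show ?thesis
        unfolding j bridge_node_odd \<omega>[OF i]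
        using Suc.IH[of i] Suc.IH[of "Suc i"] \<Xi>[OF i] i by simp
    qed
  qed
  have "bridge lam r (x r) s (x s) \<omega> = x"
    using rs(2) x(1) lipschitz_on_continuous_on[OF x(2)] nodes by (rule bridge_eqI)
  with range show thesis by (intro that[of \<omega>]) auto
qed

section \<open>Paths with free end value\<close>

lemma free_path_start_lipschitz:
  assumes c: "0 \<le> c" and lam: "mid_family c lam" and mu: "end_family c mu"
    and rs: "0 \<le> r" "r < s" and \<omega>: "\<omega> \<in> V_hat r s \<rightarrow> {0..1}"
  shows "free_path lam mu r a s \<omega> r = a"
    and "c-lipschitz_on {r..s} (free_path lam mu r a s \<omega>)"
proof -
  let ?b = "mu r a s (\<omega> s)" and ?\<omega> = "restrict \<omega> (V r s)"
  have "?b \<in> mu r a s ` {0..1}" using \<omega> unfolding V_hat_def by blast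
  then have b: "\<bar>?b - a\<bar> \<le> c * (s - r)" unfolding end_family_image[OF mu rs] by simp
  have \<omega>': "?\<omega> \<in> V r s \<rightarrow> {0..1}" using \<omega> unfolding V_hat_def by auto
  note B = bridge_lipschitz_nodes[OF c lam rs b \<omega>']
  show "free_path lam mu r a s \<omega> r = a"
    using B(2)[of 0 0] unfolding free_path_def by simp
  show "c-lipschitz_on {r..s} (free_path lam mu r a s \<omega>)"
    using B(1) unfolding free_path_def .
qed

text \<open>
  Bridges and free paths read only the coordinates that belong to their interval. This is needed
  to replace the coordinates of one piece of the half-line by a function on all of \<open>V_ray r\<close>.
\<close>

lemma bridge_node_cong:
  assumes "\<And>t. t \<in> V r s \<Longrightarrow> \<omega> t = \<omega>' t" and "j \<le> 2 ^ n"
  shows "bridge_node lam r a s b \<omega> n j = bridge_node lam r a s b \<omega>' n j"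
  using \<open>j \<le> 2 ^ n\<close>
proof (induction n arbitrary: j)
  case (Suc n)
  define i where "i = j div 2"
  show ?case
  proof (cases "even j")
    case True
    then have j: "j = 2 * i" by (simp add: i_def)
    then have "i \<le> 2 ^ n" using Suc.prems by simp
    then show ?thesis unfolding j using Suc.IH[of i] by simp
  next
    case False
    then have j: "j = 2 * i + 1" by (simp add: i_def)
    have i: "i < 2 ^ n" using Suc.prems j by simp
    show ?thesis
      unfolding j bridge_node_odd
      using Suc.IH[of i] Suc.IH[of "Suc i"] assms(1)[OF odd_dyadic_mem_V[OF i]] i by simp
  qed
qed simp

lemma bridge_cong:
  assumes "\<And>t. t \<in> V r s \<Longrightarrow> \<omega> t = \<omega>' t"
  shows "bridge lam r a s b \<omega> = bridge lam r a s b \<omega>'"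
  unfolding bridge_def using bridge_node_cong[OF assms, of r s] by (simp cong: imp_cong)

lemma free_path_cong:
  assumes "\<And>t. t \<in> V_hat r s \<Longrightarrow> \<omega> t = \<omega>' t"
  shows "free_path lam mu r a s \<omega> = free_path lam mu r a s \<omega>'"
  using assms bridge_cong[of r s "restrict \<omega> (V r s)" "restrict \<omega>' (V r s)"]
  unfolding free_path_def V_hat_def by simp

text \<open>
  The end point \<open>s\<close> is not in \<open>V r s\<close>, so its coordinate can be set to a parameter at which \<open>mu\<close> takes
  the end value of the path, without changing the bridge.
\<close>

lemma free_path_surj:
  assumes lam: "mid_family c lam" and mu: "end_family c mu" and rs: "0 \<le> r" "r < s"
    and x: "c-lipschitz_on {r..s} x"
  obtains \<omega> where "\<omega> \<in> V_hat r s \<rightarrow> {0..1}"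
    "\<And>t. t \<in> {r..s} \<Longrightarrow> free_path lam mu r (x r) s \<omega> t = x t"
proof -
  define y where "y = restrict x {r..s}"
  have y: "y \<in> extensional {r..s}" "c-lipschitz_on {r..s} y" "y r = x r" "y s = x s"
    using lipschitz_on_transform[OF x, of y] rs by (auto simp: y_def)
  obtain \<omega>0 where \<omega>0: "\<omega>0 \<in> V r s \<rightarrow> {0..1}" "bridge lam r (x r) s (x s) \<omega>0 = y"
    using bridge_surj[OF lam rs y(1,2)] y(3,4) by metis
  have "\<bar>x s - x r\<bar> \<le> c * (s - r)"
    using lipschitz_onD[OF x, of s r] rs by (simp add: dist_real_def)
  then have "x s \<in> mu r (x r) s ` {0..1}" unfolding end_family_image[OF mu rs] by simp
  then obtain \<xi> where \<xi>: "\<xi> \<in> {0..1}" "mu r (x r) s \<xi> = x s" by auto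
  define \<omega> where "\<omega> = \<omega>0(s := \<xi>)"
  have "free_path lam mu r (x r) s \<omega> = bridge lam r (x r) s (x s) \<omega>0"
    using bridge_cong[of r s "restrict \<omega> (V r s)" \<omega>0] V_subset[OF rs(2)] \<xi>(2)
    unfolding free_path_def \<omega>_def by fastforce
  then have "free_path lam mu r (x r) s \<omega> t = x t" if "t \<in> {r..s}" for t
    using that \<omega>0(2) by (simp add: y_def)
  moreover have "\<omega> \<in> V_hat r s \<rightarrow> {0..1}"
    using \<omega>0(1) \<xi>(1) by (auto simp: V_hat_def \<omega>_def)
  ultimately show thesis by (rule that[rotated])
qed

section \<open>Paths on a half-line\<close>

text \<open>
  The cut points of the half-line. Counting \<open>r\<close> itself as the number 0 treats the first piece, whose
  length need not be 1, in the same way as the unit intervals after it.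
\<close>

definition knot :: "real \<Rightarrow> nat \<Rightarrow> real" where
  "knot r k = (case k of 0 \<Rightarrow> r | Suc i \<Rightarrow> real (next_int r + i))"

lemma knot_0 [simp]: "knot r 0 = r"
  and knot_Suc [simp]: "knot r (Suc i) = real (next_int r + i)"
  by (simp_all add: knot_def)

lemma less_next_int: "r < real (next_int r)"
  unfolding next_int_def using reals_Archimedean2[of r] by (rule LeastI_ex)

lemma knot_less_Suc: "knot r k < knot r (Suc k)"
  using less_next_int[of r] by (cases k) simp_all

lemma knot_mono: "mono (knot r)"
  unfolding incseq_Suc_iff using less_imp_le[OF knot_less_Suc] by blast

lemma knot_ge: "r \<le> knot r k"
  using monoD[OF knot_mono, of 0 k r] by simp

lemma ex_knot_ge: "\<exists>k. t \<le> knot r (Suc k)"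
proof -
  obtain k where "t < real k" using reals_Archimedean2 by blast
  then show ?thesis by (intro exI[of _ k]) simp
qed

lemma knot_piece:
  assumes "r < t"
  obtains k where "knot r k < t" "t \<le> knot r (Suc k)"
proof -
  define k where "k = (LEAST k. t \<le> knot r (Suc k))"
  have "t \<le> knot r (Suc k)" unfolding k_def using ex_knot_ge by (rule LeastI_ex)
  moreover have "knot r k < t"
  proof (cases k)
    case (Suc i)
    then show ?thesis using not_less_Least[of i "\<lambda>k. t \<le> knot r (Suc k)"] k_def by force
  qed (use assms in simp)
  ultimately show thesis by (rule that[rotated])
qed

lemma knot_piece_unique:
  assumes "knot r k < t" "t \<le> knot r (Suc k)" "knot r i < t" "t \<le> knot r (Suc i)"
  shows "k = i"
proof (rule ccontr)
  assume "k \<noteq> i"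
  then have "Suc k \<le> i \<or> Suc i \<le> k" by auto
  then show False
    using monoD[OF knot_mono[of r], of "Suc k" i] monoD[OF knot_mono[of r], of "Suc i" k] assms by linarith
qed

lemma V_ray_eq: "V_ray r = (\<Union>k. V_hat (knot r k) (knot r (Suc k)))"
proof (intro equalityI subsetI)
  fix t assume "t \<in> V_ray r"
  then consider "t \<in> V_hat (knot r 0) (knot r (Suc 0))"
    | j where "next_int r \<le> j" "t \<in> V_hat (real j) (real (j + 1))"
    unfolding V_ray_def by auto
  then show "t \<in> (\<Union>k. V_hat (knot r k) (knot r (Suc k)))"
  proof cases
    case 2
    then obtain i where "j = next_int r + i" using le_Suc_ex by blast
    then have "t \<in> V_hat (knot r (Suc i)) (knot r (Suc (Suc i)))"
      using 2(2) by (simp add: add.commute add.left_commute)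
    then show ?thesis by blast
  qed blast
next
  fix t assume "t \<in> (\<Union>k. V_hat (knot r k) (knot r (Suc k)))"
  then obtain k where k: "t \<in> V_hat (knot r k) (knot r (Suc k))" by blast
  show "t \<in> V_ray r"
  proof (cases k)
    case (Suc i)
    then have "t \<in> V_hat (real (next_int r + i)) (real ((next_int r + i) + 1))"
      using k by (simp add: add.commute add.left_commute)
    then show ?thesis unfolding V_ray_def by (metis UN_I UnI2 atLeast_iff le_add1)
  qed (use k in \<open>simp add: V_ray_def\<close>)
qed

lemma ray_path_eq_ray_upto:
  assumes "r \<le> t" "t \<le> knot r (Suc k)" "\<And>i. k = Suc i \<Longrightarrow> knot r k < t"
  shows "ray_path lam mu r a \<omega> t = ray_upto lam mu r a \<omega> k t"
proof -
  have "(LEAST i. t \<le> real (next_int r + i)) = k"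
  proof (rule Least_equality)
    show "t \<le> real (next_int r + k)" using assms(2) by simp
    fix i assume i: "t \<le> real (next_int r + i)"
    show "k \<le> i"
    proof (cases k)
      case (Suc l)
      then have "real (next_int r + l) < t" using assms(3)[OF Suc] by simp
      then have "real (next_int r + l) < real (next_int r + i)" using i by linarith
      then show ?thesis using Suc by simp
    qed simp
  qed
  then show ?thesis using assms(1) unfolding ray_path_def by simp
qed

text \<open>
  On the first piece the recursion starts from \<open>a\<close> rather than from a value of the path, which is why
  the value at \<open>r\<close> has to be known here. The left end of a later piece is excluded: there
  the path is evaluated by the preceding piece.
\<close>

lemma ray_path_piece:
  assumes t: "knot r k < t" "t \<le> knot r (Suc k)" and start: "ray_path lam mu r a \<omega> r = a"
  shows "ray_path lam mu r a \<omega> t =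
    free_path lam mu (knot r k) (ray_path lam mu r a \<omega> (knot r k)) (knot r (Suc k))
      (restrict \<omega> (V_hat (knot r k) (knot r (Suc k)))) t"
proof -
  have eq: "ray_path lam mu r a \<omega> t = ray_upto lam mu r a \<omega> k t"
    using t knot_ge[of r k] by (intro ray_path_eq_ray_upto) auto
  show ?thesis
  proof (cases k)
    case 0
    then show ?thesis using eq start by simp
  next
    case (Suc i)
    have "ray_path lam mu r a \<omega> (knot r k) = ray_upto lam mu r a \<omega> i (knot r k)"
      using Suc knot_less_Suc[of r i] knot_ge[of r k] by (intro ray_path_eq_ray_upto) auto
    then show ?thesis using eq t Suc by (simp add: Let_def add.commute add.left_commute)
  qed
qed

text \<open>
  Free paths start at the prescribed value, so on each piece the path of \<open>\<omega>\<close> is a free path including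
  the left end. Lipschitz functions with a common value at a cut point concatenate to a Lipschitz
  function.
\<close>

lemma ray_path_props:
  assumes c: "0 \<le> c" and lam: "mid_family c lam" and mu: "end_family c mu"
    and r: "0 \<le> r" and \<omega>: "\<omega> \<in> V_ray r \<rightarrow> {0..1}"
  shows "ray_path lam mu r a \<omega> r = a"
    and "t \<in> {knot r k..knot r (Suc k)} \<Longrightarrow> ray_path lam mu r a \<omega> t =
      free_path lam mu (knot r k) (ray_path lam mu r a \<omega> (knot r k)) (knot r (Suc k)) \<omega> t"
    and "u \<in> {r..} \<Longrightarrow> v \<in> {r..} \<Longrightarrow>
      \<bar>ray_path lam mu r a \<omega> v - ray_path lam mu r a \<omega> u\<bar> \<le> c * \<bar>v - u\<bar>"
proof -
  let ?x = "ray_path lam mu r a \<omega>"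
  have \<omega>': "\<omega> \<in> V_hat (knot r k) (knot r (Suc k)) \<rightarrow> {0..1}" for k
    using \<omega> unfolding V_ray_eq by blast
  have cong: "free_path lam mu (knot r k) d (knot r (Suc k))
      (restrict \<omega> (V_hat (knot r k) (knot r (Suc k)))) = free_path lam mu (knot r k) d (knot r (Suc k)) \<omega>"
    for k d by (rule free_path_cong) simp
  have k0: "0 \<le> knot r k" for k using knot_ge[of r k] r by linarith
  note F = free_path_start_lipschitz[OF c lam mu k0 knot_less_Suc \<omega>']
  show start: "?x r = a"
  proof -
    have "?x r = ray_upto lam mu r a \<omega> 0 r"
      using less_next_int[of r] by (intro ray_path_eq_ray_upto) auto
    also have "\<dots> = a" using cong[of 0 a] F(1)[of 0 a] by simp
    finally show ?thesis .
  qed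
  have piece: "?x t = free_path lam mu (knot r k) (?x (knot r k)) (knot r (Suc k)) \<omega> t"
    if "t \<in> {knot r k..knot r (Suc k)}" for t k
  proof (cases "t = knot r k")
    case True
    then show ?thesis using F(1) by simp
  next
    case False
    then show ?thesis using ray_path_piece[OF _ _ start, of k t] that cong by simp
  qed
  show "t \<in> {knot r k..knot r (Suc k)} \<Longrightarrow>
      ?x t = free_path lam mu (knot r k) (?x (knot r k)) (knot r (Suc k)) \<omega> t"
    by (rule piece)
  have local: "c-lipschitz_on {knot r k..knot r (Suc k)} ?x" for k
    using F(2) by (rule lipschitz_on_transform) (simp add: piece)
  have upto: "c-lipschitz_on {r..knot r k} ?x" for k
  proof (induction k)
    case 0
    then show ?case using c by (auto intro: lipschitz_onI)
  next
    case (Suc k)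
    have "c-lipschitz_on {r..knot r (Suc k)} (\<lambda>t. if t \<le> knot r k then ?x t else ?x t)"
      by (rule lipschitz_on_concat[OF Suc local]) simp
    then show ?case by simp
  qed
  show "\<bar>?x v - ?x u\<bar> \<le> c * \<bar>v - u\<bar>" if "u \<in> {r..}" "v \<in> {r..}"
  proof -
    obtain k where "max u v \<le> knot r (Suc k)" using ex_knot_ge by blast
    then show ?thesis
      using lipschitz_onD[OF upto[of "Suc k"], of v u] that by (simp add: dist_real_def)
  qed
qed

text \<open>
  The coordinates are chosen separately for each piece, starting at the value of the given path at
  its left end. That the constructed path indeed starts each piece there holds by induction, since
  it agrees with the given one on the preceding piece.
\<close>

lemma ray_path_surj:
  assumes c: "0 \<le> c" and lam: "mid_family c lam" and mu: "end_family c mu"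
    and r: "0 \<le> r" and x: "x \<in> extensional {r..}" "c-lipschitz_on {r..} x"
  obtains \<omega> where "\<omega> \<in> Omega_ray r" "ray_path lam mu r (x r) \<omega> = x"
proof -
  let ?W = "\<lambda>k. V_hat (knot r k) (knot r (Suc k))"
  have "\<exists>\<eta>. \<eta> \<in> ?W k \<rightarrow> {0..1} \<and> (\<forall>t\<in>{knot r k..knot r (Suc k)}.
      free_path lam mu (knot r k) (x (knot r k)) (knot r (Suc k)) \<eta> t = x t)" for k
  proof -
    have "c-lipschitz_on {knot r k..knot r (Suc k)} x"
      using x(2) by (rule lipschitz_on_subset) (use knot_ge[of r k] in auto)
    moreover have "0 \<le> knot r k" using knot_ge[of r k] r by linarith
    ultimately show ?thesis using free_path_surj[OF lam mu _ knot_less_Suc] by metis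
  qed
  then obtain \<eta> where \<eta>: "\<And>k. \<eta> k \<in> ?W k \<rightarrow> {0..1}"
    "\<And>k t. t \<in> {knot r k..knot r (Suc k)} \<Longrightarrow>
       free_path lam mu (knot r k) (x (knot r k)) (knot r (Suc k)) (\<eta> k) t = x t"
    by metis
  define \<omega> where "\<omega> = (\<lambda>t\<in>V_ray r. \<eta> (THE k. t \<in> ?W k) t)"
  have \<omega>: "\<omega> t = \<eta> k t" if "t \<in> ?W k" for t k
  proof -
    have "t \<in> {knot r i<..knot r (Suc i)}" if "t \<in> ?W i" for i
      using V_hat_subset[OF knot_less_Suc] that by (rule subsetD)
    then have "i = k" if "t \<in> ?W i" for i
      using that \<open>t \<in> ?W k\<close> knot_piece_unique[of r i t k]
      unfolding greaterThanAtMost_iff by blast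
    then have "(THE k. t \<in> ?W k) = k" using that by blast
    then show ?thesis using that unfolding \<omega>_def V_ray_eq by auto
  qed
  have "\<omega> t \<in> {0..1}" if t: "t \<in> V_ray r" for t
  proof -
    obtain k where k: "t \<in> ?W k" using t unfolding V_ray_eq by blast
    show ?thesis unfolding \<omega>[OF k] using \<eta>(1) k by (rule funcset_mem)
  qed
  then have Om: "\<omega> \<in> Omega_ray r" unfolding Omega_ray_def \<omega>_def by fastforce
  then have "\<omega> \<in> V_ray r \<rightarrow> {0..1}" unfolding Omega_ray_def by auto
  note R = ray_path_props[OF c lam mu r this, where a = "x r"]
  let ?y = "ray_path lam mu r (x r) \<omega>"
  have step: "?y t = x t" if "t \<in> {knot r k..knot r (Suc k)}" "?y (knot r k) = x (knot r k)" for t k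
    using R(2)[OF that(1)] free_path_cong[OF \<omega>] \<eta>(2)[OF that(1)] that(2) by simp
  have knots: "?y (knot r k) = x (knot r k)" for k
  proof (induction k)
    case 0
    show ?case using R(1) by simp
  next
    case (Suc k)
    then show ?case using step[of "knot r (Suc k)" k] knot_less_Suc[of r k] by simp
  qed
  have "?y t = x t" if t: "t \<in> {r..}" for t
  proof (cases "t = r")
    case True
    then show ?thesis using R(1) by simp
  next
    case False
    then obtain k where "knot r k < t" "t \<le> knot r (Suc k)" using t knot_piece[of r t] by auto
    then show ?thesis using step[of t k, OF _ knots] by simp
  qed
  then have "?y = x"
    using x(1) by (intro extensionalityI[of _ "{r..}"]) (auto simp: ray_path_def)
  with Om show thesis by (rule that)
qed

theorem theorem2p9:
  fixes c r :: real
    and lam :: "real \<Rightarrow> real \<Rightarrow> real \<Rightarrow> real \<Rightarrow> real \<Rightarrow> real"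
    and mu :: "real \<Rightarrow> real \<Rightarrow> real \<Rightarrow> real \<Rightarrow> real"
  assumes "c > 0"
    and "mid_family c lam"
    and "end_family c mu"
    and "r \<ge> 0"
  shows "phi_hat lam mu r ` (UNIV \<times> Omega_ray r) = Lambda_ray c r"
proof
  show "phi_hat lam mu r ` (UNIV \<times> Omega_ray r) \<subseteq> Lambda_ray c r"
  proof clarify
    fix a \<omega> assume "\<omega> \<in> Omega_ray r"
    then have "\<omega> \<in> V_ray r \<rightarrow> {0..1}" unfolding Omega_ray_def by auto
    note R = ray_path_props(3)[OF less_imp_le[OF assms(1)] assms(2-4) this, of _ _ a]
    then have "c-lipschitz_on {r..} (ray_path lam mu r a \<omega>)"
      using assms(1) by (intro lipschitz_onI) (auto simp: dist_real_def)
    then have "continuous_on {r..} (ray_path lam mu r a \<omega>)"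
      by (rule lipschitz_on_continuous_on)
    moreover have "ray_path lam mu r a \<omega> \<in> extensional {r..}" by (simp add: ray_path_def)
    ultimately show "phi_hat lam mu r (a, \<omega>) \<in> Lambda_ray c r"
      using R unfolding phi_hat_def Lambda_ray_def C_ray_def by simp
  qed
  show "Lambda_ray c r \<subseteq> phi_hat lam mu r ` (UNIV \<times> Omega_ray r)"
  proof
    fix x assume x: "x \<in> Lambda_ray c r"
    then have "c-lipschitz_on {r..} x"
      using assms(1) unfolding Lambda_ray_def by (intro lipschitz_onI) (auto simp: dist_real_def)
    moreover have "x \<in> extensional {r..}" using x unfolding Lambda_ray_def C_ray_def by simp
    ultimately obtain \<omega> where "\<omega> \<in> Omega_ray r" "ray_path lam mu r (x r) \<omega> = x"
      using ray_path_surj[OF less_imp_le[OF assms(1)] assms(2-4)] by metis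
    then show "x \<in> phi_hat lam mu r ` (UNIV \<times> Omega_ray r)"
      by (intro image_eqI[of _ _ "(x r, \<omega>)"]) (simp_all add: phi_hat_def)
  qed
qed

end
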